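(* Let $A\in\mathbb{R}^{n\times n}$ be invertible and $W\in\mathbb{R}^{n\times n}$ be symmetric positive definite. Let $S$ be a complete discrete sampling with outcomes $S_1,\dots,S_r$, $S_i\in\mathbb{R}^{n\times q_i}$, so that $\mathbf{S}=[S_1,\dots,S_r]\in\mathbb{R}^{n\times n}$ is invertible, and let $\overline{S}_i\in\mathbb{R}^{n\times q_i}$, $i=1,\dots,r$, be such that $\mathbf{S}^{-T}=[\overline{S}_1,\dots,\overline{S}_r]$. With $\gamma$ and $\Delta_r$ as defined in the context, $$\min_{p\in\Delta_r}\gamma(p)=1-\left(\sum_{i=1}^r\left\|W^{1/2}A^TS_i\overline{S}_i^TA^{-T}W^{-1/2}\right\|_F\right)^{-2}.$$
   Context: A complete discrete sampling is a random matrix $S$ with finitely many outcomes: $S=S_i\in\mathbb{R}^{n\times q_i}$ with probability $p_i$ ($i=1,\dots,r$), where each $S_i$ has full column rank and $\mathbf{S}=[S_1,\dots,S_r]\in\mathbb{R}^{n\times n}$ has full row rank. Here the matrices $S_1,\dots,S_r$ are fixed and the probability vector $p=(p_1,\dots,p_r)$ varies over the simplex $$\Delta_r=\left\{p\in\mathbb{R}^r:\ \sum_{i=1}^rp_i=1,\ p\ge0\right\}.$$ For $p\in\Delta_r$, write $Z_p=A^TS(S^TAWA^TS)^{-1}S^TA$ where $S=S_i$ with probability $p_i$, so that $$\mathbf{E}[Z_p]=\sum_{i=1}^rp_i\,A^TS_i(S_i^TAWA^TS_i)^{-1}S_i^TA,$$ and define $$\gamma(p)=1-\frac{1}{\mathrm{Tr}\left(W^{-1/2}(\mathbf{E}[Z_p])^{-1}W^{-1/2}\right)}.$$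 If some $p_i=0$, then $\mathbf{E}[Z_p]$ is singular; in this case the trace is read as $+\infty$, i.e. $\gamma(p)=1$. $\|\cdot\|_F$ is the Frobenius norm and $M^{-T}=(M^{-1})^T$. *)

theory Defs
  imports
    Complex_Main
    "Jordan_Normal_Form.Matrix"
    "Jordan_Normal_Form.Gauss_Jordan_Elimination"
    "Jordan_Normal_Form.DL_Rank"
begin

text \<open>Blocks have different widths, so matrices are carrier-based. The library's partial inverse is
  made total; the value at singular matrices is unspecified and is never relied upon.\<close>

definition minv :: "real mat \<Rightarrow> real mat" where
  "minv M = the (mat_inverse M)"

definition mtrace :: "real mat \<Rightarrow> real" where
  "mtrace M = (\<Sum>i<dim_row M. M $$ (i, i))"

definition frobenius_norm :: "real mat \<Rightarrow> real" where
  "frobenius_norm M = sqrt (\<Sum>i<dim_row M. \<Sum>j<dim_col M. (M $$ (i, j))\<^sup>2)"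

definition sym_pos_def :: "nat \<Rightarrow> real mat \<Rightarrow> bool" where
  "sym_pos_def n M \<longleftrightarrow> M \<in> carrier_mat n n \<and> transpose_mat M = M \<and>
     (\<forall>x \<in> carrier_vec n. x \<noteq> 0\<^sub>v n \<longrightarrow> x \<bullet> (M *\<^sub>v x) > 0)"

text \<open>The principal square root, for symmetric positive definite arguments only.\<close>

definition msqrt :: "real mat \<Rightarrow> real mat" where
  "msqrt M = (THE R. sym_pos_def (dim_row M) R \<and> R * R = M)"

definition block_row :: "nat \<Rightarrow> nat \<Rightarrow> (nat \<Rightarrow> real mat) \<Rightarrow> real mat" where
  "block_row n r S = mat_of_cols n (concat (map (\<lambda>i. cols (S i)) [0..<r]))"

text \<open>The outcomes are \<open>S 0, \<dots>, S (r - 1)\<close>. Only they are constrained here, since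
  the probabilities vary over the simplex. Outcomes have at least one column: otherwise an outcome
  of probability zero would not make the expected projection singular.\<close>

definition complete_discrete_sampling ::
  "nat \<Rightarrow> nat \<Rightarrow> (nat \<Rightarrow> nat) \<Rightarrow> (nat \<Rightarrow> real mat) \<Rightarrow> bool" where
  "complete_discrete_sampling n r q S \<longleftrightarrow>
     (\<forall>i<r. 0 < q i \<and> S i \<in> carrier_mat n (q i) \<and> vec_space.rank n (S i) = q i) \<and>
     block_row n r S \<in> carrier_mat n n \<and> vec_space.rank n (block_row n r S) = n"

definition prob_simplex :: "nat \<Rightarrow> real vec set" where
  "prob_simplex r = {p \<in> carrier_vec r. (\<Sum>i<r. p $ i) = 1 \<and> (\<forall>i<r. 0 \<le> p $ i)}"

definition Zmat :: "real mat \<Rightarrow> real mat \<Rightarrow> real mat \<Rightarrow> real mat" where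
  "Zmat A W T = transpose_mat A * T *
     minv (transpose_mat T * A * W * transpose_mat A * T) * transpose_mat T * A"

text \<open>The expectation is written entrywise because carrier-based matrices of unspecified dimension
  form no additive monoid, so \<open>sum\<close> does not apply to them directly.\<close>

definition EZ :: "nat \<Rightarrow> nat \<Rightarrow> real mat \<Rightarrow> real mat \<Rightarrow> (nat \<Rightarrow> real mat) \<Rightarrow> real vec \<Rightarrow> real mat" where
  "EZ n r A W S p = mat n n (\<lambda>(a, b). \<Sum>i<r. p $ i * Zmat A W (S i) $$ (a, b))"

text \<open>For a singular expectation the trace is read as infinite, so its reciprocal vanishes.\<close>

definition gamma_rate ::
  "nat \<Rightarrow> nat \<Rightarrow> real mat \<Rightarrow> real mat \<Rightarrow> (nat \<Rightarrow> real mat) \<Rightarrow> real vec \<Rightarrow> real" where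
  "gamma_rate n r A W S p =
     (if invertible_mat (EZ n r A W S p)
      then 1 - 1 / mtrace (minv (msqrt W) * minv (EZ n r A W S p) * minv (msqrt W))
      else 1)"

end

theory Submission
  imports Defs "Jordan_Normal_Form.Char_Poly"
begin

text \<open>Put \<open>T\<^sub>i = A\<^sup>T S\<^sub>i\<close>, \<open>U\<^sub>i = A\<inverse> Sbar\<^sub>i\<close> and \<open>G\<^sub>i = T\<^sub>i\<^sup>T W T\<^sub>i\<close>. The blocks of \<open>\<^bold>S\<close> and of its inverse
  transpose are dual to each other, so \<open>U\<^sub>i\<^sup>T T\<^sub>j = \<delta>\<^sub>i\<^sub>j I\<close> and \<open>\<Sum>\<^sub>i T\<^sub>i U\<^sub>i\<^sup>T = I\<close>. Hence
  \<open>E[Z\<^sub>p] = \<Sum>\<^sub>i p\<^sub>i T\<^sub>i G\<^sub>i\<inverse> T\<^sub>i\<^sup>T\<close> has the explicit inverse \<open>\<Sum>\<^sub>i p\<^sub>i\<inverse> U\<^sub>i G\<^sub>i U\<^sub>i\<^sup>T\<close> when all \<open>p\<^sub>i\<close> are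
  positive, and it annihilates \<open>U\<^sub>i\<close> when \<open>p\<^sub>i = 0\<close>. The trace in the rate becomes \<open>\<Sum>\<^sub>i f\<^sub>i\<^sup>2 / p\<^sub>i\<close>
  with \<open>f\<^sub>i\<close> the Frobenius norms of the statement, and by Cauchy-Schwarz its minimum over the simplex
  is \<open>(\<Sum>\<^sub>i f\<^sub>i)\<^sup>2\<close>, attained at \<open>p\<^sub>i\<close> proportional to \<open>f\<^sub>i\<close>.\<close>

section \<open>The principal square root\<close>

text \<open>Over the complex numbers the characteristic polynomial has a root \<open>a\<close> with
  eigenvector \<open>u\<close>. By symmetry the Hermitian form \<open>s\<close> of \<open>A\<close>
  at \<open>u\<close> equals its own conjugate, and it is also \<open>a\<close> times the squared
  norm \<open>N\<close> of \<open>u\<close>. Hence \<open>a\<close> is real and a root of the real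
  characteristic polynomial.\<close>

lemma symmetric_mat_eigenvector:
  fixes A :: "real mat"
  assumes A: "A \<in> carrier_mat n n" and sym: "transpose_mat A = A" and n: "0 < n"
  shows "\<exists>v e. eigenvector A v e"
proof -
  let ?h = "complex_of_real"
  let ?A = "map_mat ?h A"
  have cA: "?A \<in> carrier_mat n n" using A by auto
  obtain as where as: "char_poly ?A = (\<Prod>a\<leftarrow>as. [:- a, 1:])" "length as = n"
    using char_poly_factorized[OF cA] by auto
  then obtain a as' where "as = a # as'" using n by (cases as) auto
  then have root: "poly (char_poly ?A) a = 0" using as by simp
  then obtain u where u: "u \<in> carrier_vec n" "u \<noteq> 0\<^sub>v n" "?A *\<^sub>v u = a \<cdot>\<^sub>v u"
    using eigenvalue_root_char_poly[OF cA] cA unfolding eigenvalue_def eigenvector_def by auto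
  have row: "(\<Sum>j<n. ?h (A $$ (i,j)) * u $ j) = a * u $ i" if "i < n" for i
  proof -
    have "(?A *\<^sub>v u) $ i = (\<Sum>j<n. ?h (A $$ (i,j)) * u $ j)"
      using that A u(1) by (auto simp: scalar_prod_def lessThan_atLeast0 intro!: sum.cong)
    then show ?thesis using u that by auto
  qed
  have symA: "A $$ (i,j) = A $$ (j,i)" if "i < n" "j < n" for i j
    using arg_cong[OF sym, of "\<lambda>M. M $$ (j,i)"] A that by auto
  define s where "s = (\<Sum>i<n. \<Sum>j<n. ?h (A $$ (i,j)) * cnj (u $ i) * u $ j)"
  define N where "N = (\<Sum>i<n. (cmod (u $ i))\<^sup>2)"
  have "cnj s = (\<Sum>i<n. \<Sum>j<n. ?h (A $$ (j,i)) * u $ i * cnj (u $ j))"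
    unfolding s_def by (auto simp: symA intro!: sum.cong)
  also have "\<dots> = s" unfolding s_def by (subst sum.swap) (simp add: mult_ac)
  finally have real_s: "s \<in> \<real>" by (simp add: Reals_cnj_iff)
  have "s = (\<Sum>i<n. cnj (u $ i) * (\<Sum>j<n. ?h (A $$ (i,j)) * u $ j))"
    unfolding s_def sum_distrib_left by (simp add: mult_ac)
  also have "\<dots> = a * ?h N"
    unfolding N_def of_real_sum sum_distrib_left[of a]
    by (rule sum.cong, simp, simp only: row lessThan_iff)
      (simp add: complex_norm_square mult_ac del: of_real_power)
  finally have s: "s = a * ?h N" .
  have "N \<noteq> 0"
  proof
    assume "N = 0"
    then have "\<forall>i<n. u $ i = 0" unfolding N_def by (subst (asm) sum_nonneg_eq_0_iff) auto
    then show False using u(1,2) by (auto simp: vec_eq_iff)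
  qed
  then have "a = s / ?h N" using s by simp
  then have "a \<in> \<real>" using real_s by auto
  then obtain e where e: "a = ?h e" by (auto elim: Reals_cases)
  have "?h (poly (char_poly A) e) = 0"
    using root unfolding e of_real_hom.char_poly_hom[OF A] by simp
  then have "eigenvalue A e" using eigenvalue_root_char_poly[OF A] by simp
  then show ?thesis unfolding eigenvalue_def by blast
qed

text \<open>The Householder matrix I - 2 u u^T / c, with u = v - e_0 and c = u . u, exchanges the
  unit vectors v and e_0. For v = e_0 the vector u vanishes, and the identity serves.\<close>

lemma householder_reflection:
  fixes v :: "real vec"
  assumes v: "v \<in> carrier_vec n" and unit: "v \<bullet> v = 1" and n: "0 < n"
  shows "\<exists>H \<in> carrier_mat n n. transpose_mat H = H \<and> H * H = 1\<^sub>m n \<and> H *\<^sub>v unit_vec n 0 = v"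
proof (cases "v = unit_vec n 0")
  case True
  then show ?thesis by (intro bexI[of _ "1\<^sub>m n"]) auto
next
  case False
  define d where "d i j = (if i = j then 1 else 0 :: real)" for i j :: nat
  define u where "u i = v $ i - d i 0" for i
  define c where "c = (\<Sum>i<n. u i * u i)"
  define H where "H = mat n n (\<lambda>(i,j). d i j - 2 * u i * u j / c)"
  have d_sum: "(\<Sum>k<n. d k j * f k) = f j" if "j < n" for j f
    using that by (simp add: d_def if_distrib[of "\<lambda>x. x * _"] cong: if_cong)
  have d_sym: "d i j = d j i" for i j by (simp add: d_def)
  have vv: "(\<Sum>i<n. v $ i * v $ i) = 1"
    using unit v by (simp add: scalar_prod_def lessThan_atLeast0)
  have "c = (\<Sum>i<n. v $ i * v $ i - 2 * (d i 0 * v $ i) + d i 0 * d i 0)"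
    unfolding c_def u_def by (simp add: algebra_simps)
  also have "\<dots> = 1 - 2 * v $ 0 + d 0 0"
    using n by (simp add: sum.distrib sum_subtractf vv d_sum flip: sum_distrib_left)
  finally have c: "c = 2 - 2 * v $ 0" by (simp add: d_def)
  have "c \<noteq> 0"
  proof
    assume "c = 0"
    then have "\<forall>i<n. u i = 0" unfolding c_def by (subst (asm) sum_nonneg_eq_0_iff) auto
    then show False using False v by (auto simp: u_def d_def vec_eq_iff unit_vec_def)
  qed
  have "(\<Sum>k<n. (d i k - 2 * u i * u k / c) * (d k j - 2 * u k * u j / c)) = d i j"
    if "i < n" "j < n" for i j
  proof -
    have "(\<Sum>k<n. (d i k - 2 * u i * u k / c) * (d k j - 2 * u k * u j / c))
      = (\<Sum>k<n. d k i * d k j - 2 * u j / c * (d k i * u k) - 2 * u i / c * (d k j * u k)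
           + 4 * u i * u j / (c * c) * (u k * u k))"
      by (rule sum.cong) (auto simp: d_sym[of i] algebra_simps)
    also have "\<dots> = d i j - 2 * u j / c * u i - 2 * u i / c * u j + 4 * u i * u j / (c * c) * c"
      by (simp only: sum.distrib sum_subtractf sum_distrib_left[symmetric] d_sum[OF that(1)] d_sum[OF that(2)]
          c_def[symmetric] d_sym[of j i])
    also have "\<dots> = d i j" using \<open>c \<noteq> 0\<close> by (simp add: field_simps)
    finally show ?thesis .
  qed
  then have "H * H = 1\<^sub>m n"
    by (intro eq_matI) (auto simp: H_def d_def scalar_prod_def lessThan_atLeast0)
  moreover have "H *\<^sub>v unit_vec n 0 = v"
  proof (rule eq_vecI)
    fix i assume "i < dim_vec v"
    then have i: "i < n" using v by simp
    have "(H *\<^sub>v unit_vec n 0) $ i = d i 0 - 2 * u i * u 0 / c"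
      using i n by (simp add: H_def)
    \<comment> \<open>Since \<open>c = 2 - 2 * v $ 0\<close>, the subtracted term becomes an added
      \<open>u i\<close>, and \<open>d i 0 + u i\<close> is \<open>v $ i\<close>.\<close>
    also have "u 0 = - c / 2" by (simp add: u_def c d_def)
    finally show "(H *\<^sub>v unit_vec n 0) $ i = v $ i" using \<open>c \<noteq> 0\<close> by (simp add: u_def field_simps)
  qed (use v in \<open>auto simp: H_def\<close>)
  moreover have "transpose_mat H = H"
    by (rule eq_matI) (auto simp: H_def d_sym mult_ac)
  ultimately show ?thesis by (intro bexI[of _ H]) (auto simp: H_def)
qed

text \<open>The left inverse \<open>L\<close> makes \<open>P\<close> injective, so a nonzero
  \<open>x\<close> gives a nonzero \<open>y\<close>, and the new form at \<open>x\<close> is the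
  form of \<open>A\<close> at \<open>y\<close>.\<close>

lemma sym_pos_def_congruence:
  assumes A: "sym_pos_def n A" and P: "P \<in> carrier_mat n m"
    and L: "L \<in> carrier_mat m n" "L * P = 1\<^sub>m m"
  shows "sym_pos_def m (transpose_mat P * A * P)"
proof -
  have cA: "A \<in> carrier_mat n n" and symA: "transpose_mat A = A"
    and pos: "\<And>x. x \<in> carrier_vec n \<Longrightarrow> x \<noteq> 0\<^sub>v n \<Longrightarrow> x \<bullet> (A *\<^sub>v x) > 0"
    using A unfolding sym_pos_def_def by auto
  have cPA: "transpose_mat P * A \<in> carrier_mat m n" using P cA by auto
  have "transpose_mat (transpose_mat P * A * P) = transpose_mat P * transpose_mat (transpose_mat P * A)"
    using transpose_mult[OF cPA P] .
  also have "transpose_mat (transpose_mat P * A) = A * P"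
    using transpose_mult[of "transpose_mat P" m n A n] P cA symA by simp
  finally have sym: "transpose_mat (transpose_mat P * A * P) = transpose_mat P * A * P"
    using P cA by (simp add: assoc_mult_mat[of _ m n _ n _ m])
  have "x \<bullet> (transpose_mat P * A * P *\<^sub>v x) > 0" if x: "x \<in> carrier_vec m" "x \<noteq> 0\<^sub>v m" for x
  proof -
    define y where "y = P *\<^sub>v x"
    have y: "y \<in> carrier_vec n" using P x by (auto simp: y_def)
    have "L *\<^sub>v y = x" unfolding y_def using L P x
      by (metis assoc_mult_mat_vec one_mult_mat_vec)
    then have "y \<noteq> 0\<^sub>v n" using x L(1) by (auto simp: mult_mat_vec_def)
    have "transpose_mat P * A * P *\<^sub>v x = transpose_mat P *\<^sub>v (A *\<^sub>v y)"
      unfolding y_def using P cA x by (simp add: assoc_mult_mat_vec[of _ m n _ m] assoc_mult_mat_vec[of _ m n _ n] cPA)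
    then have "x \<bullet> (transpose_mat P * A * P *\<^sub>v x) = y \<bullet> (A *\<^sub>v y)"
      using transpose_vec_mult_scalar[of P n m x "A *\<^sub>v y"] P cA x y
      by (metis comm_scalar_prod mult_mat_vec_carrier transpose_carrier_mat y_def)
    then show ?thesis using pos[OF y \<open>y \<noteq> 0\<^sub>v n\<close>] by simp
  qed
  then show ?thesis using sym P cA unfolding sym_pos_def_def by auto
qed

lemma quadratic_form_sum:
  fixes M :: "real mat"
  assumes "M \<in> carrier_mat n n" "x \<in> carrier_vec n"
  shows "x \<bullet> (M *\<^sub>v x) = (\<Sum>i<n. \<Sum>j<n. x $ i * (M $$ (i,j) * x $ j))"
  using assms by (simp add: scalar_prod_def lessThan_atLeast0 sum_distrib_left)

text \<open>The quadratic form of the block diagonal matrix with blocks \<open>e\<close> and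
  \<open>R\<close> splits into a square in the first coordinate and the form of \<open>R\<close> in
  the tail; a nonzero \<open>x\<close> makes one of them positive.\<close>

lemma sym_pos_def_border:
  fixes e :: real and R :: "real mat"
  assumes R: "sym_pos_def m R" and e: "0 < e"
  defines "B \<equiv> mat (Suc m) (Suc m)
    (\<lambda>(i,j). case i of 0 \<Rightarrow> (case j of 0 \<Rightarrow> e | Suc l \<Rightarrow> 0) | Suc k \<Rightarrow> (case j of 0 \<Rightarrow> 0 | Suc l \<Rightarrow> R $$ (k,l)))"
  shows "sym_pos_def (Suc m) B"
proof -
  have cR: "R \<in> carrier_mat m m" and symR: "transpose_mat R = R"
    and pos: "\<And>x. x \<in> carrier_vec m \<Longrightarrow> x \<noteq> 0\<^sub>v m \<Longrightarrow> x \<bullet> (R *\<^sub>v x) > 0"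
    using R unfolding sym_pos_def_def by auto
  have R_swap: "R $$ (i,j) = R $$ (j,i)" if "i < m" "j < m" for i j
    using arg_cong[OF symR, of "\<lambda>M. M $$ (j,i)"] cR that by auto
  have cB: "B \<in> carrier_mat (Suc m) (Suc m)" by (simp add: B_def)
  have "transpose_mat B = B"
    by (rule eq_matI) (auto simp: B_def R_swap split: nat.splits)
  moreover have "x \<bullet> (B *\<^sub>v x) > 0" if x: "x \<in> carrier_vec (Suc m)" "x \<noteq> 0\<^sub>v (Suc m)" for x
  proof -
    define y where "y = vec m (\<lambda>i. x $ Suc i)"
    have y: "y \<in> carrier_vec m" by (simp add: y_def)
    have "x \<bullet> (B *\<^sub>v x) = e * (x $ 0)\<^sup>2 + y \<bullet> (R *\<^sub>v y)"
      unfolding quadratic_form_sum[OF cB x(1)] quadratic_form_sum[OF cR y]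
      by (simp add: sum.lessThan_Suc_shift B_def y_def power2_eq_square del: sum.lessThan_Suc)
    moreover have "y = 0\<^sub>v m \<Longrightarrow> x $ 0 \<noteq> 0"
    proof
      assume "y = 0\<^sub>v m" "x $ 0 = 0"
      then have "x $ i = 0" if "i < Suc m" for i
        using that by (cases i) (auto simp: y_def vec_eq_iff)
      then show False using x by (auto simp: vec_eq_iff)
    qed
    moreover have "0\<^sub>v m \<bullet> (R *\<^sub>v 0\<^sub>v m) = 0" using cR by simp
    moreover have "0 \<le> e * (x $ 0)\<^sup>2" using e by simp
    moreover have "x $ 0 \<noteq> 0 \<Longrightarrow> 0 < e * (x $ 0)\<^sup>2" using e by simp
    ultimately show ?thesis using pos[OF y] by (cases "y = 0\<^sub>v m") force+
  qed
  ultimately show ?thesis using cB unfolding sym_pos_def_def by blast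
qed

text \<open>Deflation: a reflection carrying an eigenvector to the first axis splits off a 1-by-1 block,
  and the induction hypothesis applies to the complementary block.\<close>

lemma sym_pos_def_sqrt_exists:
  "sym_pos_def n A \<Longrightarrow> \<exists>R. sym_pos_def n R \<and> R * R = A"
proof (induction n arbitrary: A)
  case 0
  then show ?case by (intro exI[of _ A]) (auto simp: sym_pos_def_def intro!: eq_matI)
next
  case (Suc m)
  let ?n = "Suc m"
  have cA: "A \<in> carrier_mat ?n ?n" and symA: "transpose_mat A = A"
    and pos: "\<And>x. x \<in> carrier_vec ?n \<Longrightarrow> x \<noteq> 0\<^sub>v ?n \<Longrightarrow> x \<bullet> (A *\<^sub>v x) > 0"
    using Suc.prems unfolding sym_pos_def_def by auto
  obtain w e where w: "w \<in> carrier_vec ?n" "w \<noteq> 0\<^sub>v ?n" "A *\<^sub>v w = e \<cdot>\<^sub>v w"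
    using symmetric_mat_eigenvector[OF cA symA] cA unfolding eigenvector_def by auto
  define c where "c = w \<bullet> w"
  have "c \<ge> 0" unfolding c_def scalar_prod_def by (auto intro: sum_nonneg)
  moreover have "e * c > 0" using pos[OF w(1,2)] w by (simp add: c_def)
  ultimately have "c > 0" and e: "e > 0" by (auto simp: zero_less_mult_iff)
  define v where "v = (1 / sqrt c) \<cdot>\<^sub>v w"
  have v: "v \<in> carrier_vec ?n" using w by (simp add: v_def)
  have Av: "A *\<^sub>v v = e \<cdot>\<^sub>v v"
    using w cA by (simp add: v_def mult_mat_vec smult_smult_assoc mult.commute)
  have "v \<bullet> v = 1" using w \<open>c > 0\<close> by (simp add: v_def flip: c_def)
  then obtain H where H: "H \<in> carrier_mat ?n ?n" "transpose_mat H = H" "H * H = 1\<^sub>m ?n"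
      "H *\<^sub>v unit_vec ?n 0 = v"
    using householder_reflection[OF v] by auto
  \<comment> \<open>In the reflected coordinates the eigenvector is the first axis, so row and
    column 0 of \<open>B\<close> vanish off the diagonal.\<close>
  define B where "B = H * A * H"
  have cB: "B \<in> carrier_mat ?n ?n" using H cA by (simp add: B_def)
  have posB: "sym_pos_def ?n B"
    using sym_pos_def_congruence[OF Suc.prems H(1) H(1,3)] H(2) by (simp add: B_def)
  have "H *\<^sub>v v = unit_vec ?n 0"
    using H by (metis assoc_mult_mat_vec one_mult_mat_vec unit_vec_carrier)
  moreover have "B *\<^sub>v unit_vec ?n 0 = H *\<^sub>v (A *\<^sub>v (H *\<^sub>v unit_vec ?n 0))"
    unfolding B_def using H cA by (simp add: assoc_mult_mat_vec[of _ ?n ?n _ ?n])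
  ultimately have "B *\<^sub>v unit_vec ?n 0 = e \<cdot>\<^sub>v unit_vec ?n 0"
    using H Av v by (simp add: mult_mat_vec)
  then have col0: "B $$ (i,0) = (if i = 0 then e else 0)" if "i < ?n" for i
  proof -
    have "B $$ (i,0) = (B *\<^sub>v unit_vec ?n 0) $ i" using that cB by simp
    then show ?thesis using that by (simp add: \<open>B *\<^sub>v unit_vec ?n 0 = e \<cdot>\<^sub>v unit_vec ?n 0\<close>)
  qed
  have row0: "B $$ (0,i) = (if i = 0 then e else 0)" if "i < ?n" for i
  proof -
    have "transpose_mat B = B" using posB unfolding sym_pos_def_def by auto
    then have "B $$ (0,i) = B $$ (i,0)" using that cB index_transpose_mat(1)[of 0 B i] by auto
    then show ?thesis using col0[OF that] by simp
  qed
  \<comment> \<open>\<open>P\<close> embeds the last \<open>m\<close> coordinates; compressing by it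
    cuts out the lower right block of \<open>B\<close>.\<close>
  define P where "P = mat ?n m (\<lambda>(i,j). if i = Suc j then 1 else 0 :: real)"
  have cP: "P \<in> carrier_mat ?n m" by (simp add: P_def)
  have BP: "(B * P) $$ (i,j) = B $$ (i, Suc j)" if "i < ?n" "j < m" for i j
    using that cB by (simp add: P_def scalar_prod_def if_distrib[of "\<lambda>x. _ * x"] cong: if_cong)
  have PBP: "(transpose_mat P * (B * P)) $$ (i,j) = B $$ (Suc i, Suc j)" if "i < m" "j < m" for i j
  proof -
    have "(transpose_mat P * (B * P)) $$ (i,j) = (\<Sum>k<?n. P $$ (k,i) * (B * P) $$ (k,j))"
      using that cB cP by (simp add: scalar_prod_def lessThan_atLeast0 del: sum.lessThan_Suc sum.op_ivl_Suc)
    also have "\<dots> = (\<Sum>k<?n. (if k = Suc i then B $$ (k, Suc j) else 0))"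
      using that by (intro sum.cong refl) (auto simp: BP, auto simp: P_def)
    finally show ?thesis using that by simp
  qed
  have "transpose_mat P * P = 1\<^sub>m m"
    by (rule eq_matI) (auto simp: P_def scalar_prod_def if_distrib[of "\<lambda>x. x * _"] cong: if_cong)
  from sym_pos_def_congruence[OF posB cP _ this] cP
  have "sym_pos_def m (transpose_mat P * B * P)" by simp
  moreover have "transpose_mat P * B * P = transpose_mat P * (B * P)"
    using cP cB by (intro assoc_mult_mat) auto
  ultimately obtain R3 where R3: "sym_pos_def m R3" "R3 * R3 = transpose_mat P * (B * P)"
    using Suc.IH by metis
  then have cR3: "R3 \<in> carrier_mat m m" by (simp add: sym_pos_def_def)
  \<comment> \<open>Block diagonal root of \<open>B\<close>: \<open>sqrt e\<close> for the split-off
    eigenvalue, \<open>R3\<close> from the induction hypothesis.\<close>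
  define Q where "Q = mat ?n ?n
    (\<lambda>(i,j). case i of 0 \<Rightarrow> (case j of 0 \<Rightarrow> sqrt e | Suc l \<Rightarrow> 0) | Suc k \<Rightarrow> (case j of 0 \<Rightarrow> 0 | Suc l \<Rightarrow> R3 $$ (k,l)))"
  have posQ: "sym_pos_def ?n Q"
    unfolding Q_def by (rule sym_pos_def_border) (use R3 e in auto)
  have cQ: "Q \<in> carrier_mat ?n ?n" by (simp add: Q_def)
  have "Q * Q = B"
  proof (rule eq_matI)
    fix i j assume "i < dim_row B" "j < dim_col B"
    then have ij: "i < ?n" "j < ?n" using cB by auto
    have "(Q * Q) $$ (i,j) = (\<Sum>k<?n. Q $$ (i,k) * Q $$ (k,j))"
      using ij cQ by (simp add: scalar_prod_def lessThan_atLeast0 del: sum.lessThan_Suc sum.op_ivl_Suc)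
    also have "\<dots> = Q $$ (i,0) * Q $$ (0,j) + (\<Sum>k<m. Q $$ (i,Suc k) * Q $$ (Suc k,j))"
      by (simp add: sum.lessThan_Suc_shift del: sum.lessThan_Suc)
    also have "\<dots> = B $$ (i,j)"
    proof (cases i)
      case 0
      then show ?thesis using ij e by (cases j) (auto simp: Q_def row0)
    next
      case (Suc k)
      show ?thesis
      proof (cases j)
        case 0
        then show ?thesis using ij e Suc by (auto simp: Q_def col0)
      next
        case l: (Suc l)
        have "(\<Sum>a<m. R3 $$ (k,a) * R3 $$ (a,l)) = (R3 * R3) $$ (k,l)"
          using cR3 ij Suc l by (simp add: scalar_prod_def lessThan_atLeast0)
        also have "\<dots> = B $$ (Suc k, Suc l)" using R3(2) PBP ij Suc l by simp
        finally show ?thesis using ij Suc l by (simp add: Q_def)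
      qed
    qed
    finally show "(Q * Q) $$ (i,j) = B $$ (i,j)" .
  qed (use cQ cB in auto)
  \<comment> \<open>Back to the original coordinates; the inner reflections cancel on
    squaring.\<close>
  define R where "R = H * Q * H"
  have "sym_pos_def ?n R"
    using sym_pos_def_congruence[OF posQ H(1) H(1,3)] H(2) by (simp add: R_def)
  moreover have "R * R = A"
  proof -
    note cs = H(1) cQ cA
    have "R * R = H * Q * (H * H) * Q * H"
      unfolding R_def using cs by (simp add: assoc_mult_mat[of _ ?n ?n _ ?n _ ?n])
    also have "\<dots> = H * (Q * Q) * H"
      using cs H(3) by (simp add: assoc_mult_mat[of _ ?n ?n _ ?n _ ?n])
    also have "\<dots> = (H * H) * A * (H * H)"
      unfolding \<open>Q * Q = B\<close> B_def using cs by (simp add: assoc_mult_mat[of _ ?n ?n _ ?n _ ?n])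
    also have "\<dots> = A" using cs H(3) by simp
    finally show ?thesis .
  qed
  ultimately show ?case by blast
qed

text \<open>With \<open>X = R - Q\<close>, equal squares give \<open>R X + X Q = 0\<close>, whose inner product with \<open>X\<close>
  is a sum of quadratic forms of \<open>R\<close> and \<open>Q\<close> in the columns and rows of \<open>X\<close>.\<close>

lemma sym_pos_def_sqrt_unique:
  assumes R: "sym_pos_def n R" and Q: "sym_pos_def n Q" and eq: "R * R = Q * Q"
  shows "R = Q"
proof -
  have cR: "R \<in> carrier_mat n n" and cQ: "Q \<in> carrier_mat n n" and symQ: "transpose_mat Q = Q"
    using R Q unfolding sym_pos_def_def by auto
  have nonneg: "0 \<le> x \<bullet> (M *\<^sub>v x)" if "sym_pos_def n M" "x \<in> carrier_vec n" for M x
    using that unfolding sym_pos_def_def by (cases "x = 0\<^sub>v n") (auto intro: less_imp_le)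
  have Q_swap: "Q $$ (i,j) = Q $$ (j,i)" if "i < n" "j < n" for i j
    using arg_cong[OF symQ, of "\<lambda>M. M $$ (j,i)"] cQ that by auto
  define X where "X = R - Q"
  have cX: "X \<in> carrier_mat n n" unfolding X_def using cQ by (rule minus_carrier_mat)
  have "R * X + X * Q = (R * R - R * Q) + (R * Q - Q * Q)"
    unfolding X_def using cR cQ by (simp add: mult_minus_distrib_mat minus_mult_distrib_mat)
  also have "\<dots> = 0\<^sub>m n n" unfolding eq using cR cQ by (intro eq_matI) auto
  finally have zero: "R * X + X * Q = 0\<^sub>m n n" .
  have "0 = (\<Sum>i<n. \<Sum>j<n. X $$ (i,j) * (R * X + X * Q) $$ (i,j))"
    unfolding zero by simp
  also have "\<dots> = (\<Sum>i<n. \<Sum>j<n. \<Sum>k<n. X $$ (i,j) * (R $$ (i,k) * X $$ (k,j)))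
      + (\<Sum>i<n. \<Sum>j<n. \<Sum>k<n. X $$ (i,j) * (X $$ (i,k) * Q $$ (k,j)))"
    using cX cR cQ
    by (simp add: scalar_prod_def lessThan_atLeast0 ring_distribs sum.distrib sum_distrib_left)
  also have "(\<Sum>i<n. \<Sum>j<n. \<Sum>k<n. X $$ (i,j) * (R $$ (i,k) * X $$ (k,j)))
      = (\<Sum>j<n. col X j \<bullet> (R *\<^sub>v col X j))"
    using cX by (subst sum.swap) (auto simp: quadratic_form_sum[OF cR] intro!: sum.cong)
  \<comment> \<open>Symmetry of \<open>Q\<close> turns multiplication from the right into forms in
    the rows of \<open>X\<close>.\<close>
  also have "(\<Sum>i<n. \<Sum>j<n. \<Sum>k<n. X $$ (i,j) * (X $$ (i,k) * Q $$ (k,j)))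
      = (\<Sum>i<n. row X i \<bullet> (Q *\<^sub>v row X i))"
    using cX by (auto simp: quadratic_form_sum[OF cQ] Q_swap mult_ac intro!: sum.cong)
  finally have sum0: "(\<Sum>j<n. col X j \<bullet> (R *\<^sub>v col X j)) + (\<Sum>i<n. row X i \<bullet> (Q *\<^sub>v row X i)) = 0"
    by simp
  have "(\<Sum>i<n. row X i \<bullet> (Q *\<^sub>v row X i)) \<ge> 0"
    using cX by (intro sum_nonneg nonneg[OF Q]) auto
  moreover have nn: "0 \<le> col X j \<bullet> (R *\<^sub>v col X j)" for j
    using cX by (intro nonneg[OF R]) auto
  moreover have "(\<Sum>j<n. col X j \<bullet> (R *\<^sub>v col X j)) \<ge> 0"
    using nn by (intro sum_nonneg) auto
  \<comment> \<open>Two nonnegative sums add up to 0, so both vanish; the columns then suffice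
    because \<open>R\<close> is definite.\<close>
  ultimately have "(\<Sum>j<n. col X j \<bullet> (R *\<^sub>v col X j)) = 0" using sum0 by linarith
  then have col0: "\<forall>j<n. col X j \<bullet> (R *\<^sub>v col X j) = 0"
    using nn by (subst (asm) sum_nonneg_eq_0_iff) auto
  have "col X j = 0\<^sub>v n" if "j < n" for j
  proof (rule ccontr)
    assume "col X j \<noteq> 0\<^sub>v n"
    then have "col X j \<bullet> (R *\<^sub>v col X j) > 0"
      using R cX that unfolding sym_pos_def_def by auto
    then show False using col0 that by simp
  qed
  then have "X $$ (i,j) = 0" if "i < n" "j < n" for i j
    using that cX by (metis carrier_matD index_col index_zero_vec(1))
  then show ?thesis using cR cQ by (intro eq_matI) (auto simp: X_def)
qed

text \<open>Existence and uniqueness together discharge the definite description in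
  \<open>msqrt\<close>.\<close>

lemma msqrt:
  assumes "sym_pos_def n W"
  shows "sym_pos_def n (msqrt W)" "msqrt W * msqrt W = W"
proof -
  obtain R where R: "sym_pos_def n R" "R * R = W" using sym_pos_def_sqrt_exists[OF assms] by auto
  have "dim_row W = n" using assms by (auto simp: sym_pos_def_def)
  then have "msqrt W = R" unfolding msqrt_def
    using R sym_pos_def_sqrt_unique by (intro the_equality) auto
  then show "sym_pos_def n (msqrt W)" "msqrt W * msqrt W = W" using R by auto
qed

section \<open>Inverses, sums and block rows of matrices\<close>

text \<open>Block \<open>i\<close> starts after the widths of all earlier blocks. Induction on
  \<open>r\<close>: either \<open>i\<close> is the last block, or the position already lies in the
  shorter concatenation.\<close>

lemma concat_nth_offset:
  assumes len: "\<And>i. i < r \<Longrightarrow> length (f i) = q i" and i: "i < r" and k: "k < q i"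
  shows "(\<Sum>j<i. q j) + k < (\<Sum>j<r. q j)"
    and "concat (map f [0..<r]) ! ((\<Sum>j<i. q j) + k) = f i ! k"
proof -
  have bound: "(\<Sum>j<i. q j) + k < (\<Sum>j<m. q j)" if "i < m" for m
  proof -
    have "(\<Sum>j<i. q j) + k < (\<Sum>j<Suc i. q j)" using k by simp
    also have "\<dots> \<le> (\<Sum>j<m. q j)" using that by (intro sum_mono2) auto
    finally show ?thesis .
  qed
  show "(\<Sum>j<i. q j) + k < (\<Sum>j<r. q j)" using bound i .
  show "concat (map f [0..<r]) ! ((\<Sum>j<i. q j) + k) = f i ! k"
    using len i
  proof (induction r)
    case (Suc r)
    have "length (concat (map f [0..<r])) = (\<Sum>j<r. q j)"
      using Suc.prems(1) by (simp add: length_concat sum_list_sum_nth lessThan_atLeast0)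
    then show ?case using Suc bound[of r] k by (auto simp: nth_append less_Suc_eq)
  qed simp
qed

text \<open>A position inside a block lies before the start of every later block. This allows the
  identity matrix to be read block by block.\<close>

lemma offset_inject:
  fixes q :: "nat \<Rightarrow> nat"
  assumes "(\<Sum>a<i. q a) + k = (\<Sum>a<j. q a) + l" "k < q i" "l < q j"
  shows "i = j \<and> k = l"
proof -
  have le: "(\<Sum>a<i. q a) + k < (\<Sum>a<j. q a)" if "i < j" "k < q i" for i j k
  proof -
    have "(\<Sum>a<i. q a) + k < (\<Sum>a<Suc i. q a)" using that by simp
    also have "\<dots> \<le> (\<Sum>a<j. q a)" using that by (intro sum_mono2) auto
    finally show ?thesis .
  qed
  show ?thesis using assms le[of i j k] le[of j i l] by (cases rule: linorder_cases[of i j]) auto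
qed

text \<open>Regroups a sum over all columns by block, which turns a product of block rows into a sum
  of products of blocks.\<close>

lemma sum_offset:
  fixes g :: "nat \<Rightarrow> 'a::comm_monoid_add" and q :: "nat \<Rightarrow> nat"
  shows "(\<Sum>c<(\<Sum>i<r. q i). g c) = (\<Sum>i<r. \<Sum>k<q i. g ((\<Sum>j<i. q j) + k))"
proof -
  have split: "(\<Sum>c<a + b. g c) = (\<Sum>c<a. g c) + (\<Sum>k<b. g (a + k))" for a b :: nat
    by (induction b) (auto simp: add.assoc)
  show ?thesis by (induction r) (auto simp: split)
qed

lemma block_row_index:
  assumes S: "\<And>i. i < r \<Longrightarrow> S i \<in> carrier_mat n (q i)"
  shows "block_row n r S \<in> carrier_mat n (\<Sum>i<r. q i)"
    and "\<lbrakk>i < r; k < q i; a < n\<rbrakk> \<Longrightarrow> block_row n r S $$ (a, (\<Sum>j<i. q j) + k) = S i $$ (a, k)"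
proof -
  let ?cs = "concat (map (\<lambda>i. cols (S i)) [0..<r])"
  have len: "length (cols (S i)) = q i" if "i < r" for i using S[OF that] by simp
  have "length ?cs = (\<Sum>i<r. q i)"
    by (simp add: length_concat sum_list_sum_nth lessThan_atLeast0 len del: cols_length)
  then show carrier: "block_row n r S \<in> carrier_mat n (\<Sum>i<r. q i)"
    unfolding block_row_def by auto
  assume "i < r" "k < q i" "a < n"
  then show "block_row n r S $$ (a, (\<Sum>j<i. q j) + k) = S i $$ (a, k)"
    using concat_nth_offset[of r "\<lambda>i. cols (S i)" q i k, OF len] S[of i] \<open>length ?cs = _\<close>
    unfolding block_row_def by (simp add: mat_of_cols_index)
qed

section \<open>Inverses of square matrices\<close>

text \<open>A right inverse of a square matrix is two-sided, so \<open>mat_inverse\<close> does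
  return a value, and uniqueness of inverses identifies it with \<open>N\<close>.\<close>

lemma minv_unique:
  assumes M: "M \<in> carrier_mat n n" and N: "N \<in> carrier_mat n n" and MN: "M * N = 1\<^sub>m n"
  shows "minv M = N"
proof -
  have NM: "N * M = 1\<^sub>m n" using mat_mult_left_right_inverse[OF M N MN] .
  have "M \<in> Units (ring_mat TYPE(real) n ())"
    using M N MN NM unfolding Units_def ring_mat_def by auto
  then obtain B where B: "mat_inverse M = Some B"
    using mat_inverse(1)[OF M, of "()"] by (cases "mat_inverse M") auto
  then have "M * B = 1\<^sub>m n" "B \<in> carrier_mat n n" using mat_inverse(2)[OF M B] by auto
  then have "B = N" using M N NM by (metis assoc_mult_mat left_mult_one_mat right_mult_one_mat)
  then show ?thesis using B by (simp add: minv_def)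
qed

lemma minv_det_nonzero:
  assumes M: "M \<in> carrier_mat n n" and det: "det M \<noteq> 0"
  shows "minv M \<in> carrier_mat n n" "M * minv M = 1\<^sub>m n" "minv M * M = 1\<^sub>m n"
proof -
  have "M \<in> Units (ring_mat TYPE(real) n ())" using det_non_zero_imp_unit[OF M det] .
  then obtain B where B: "mat_inverse M = Some B"
    using mat_inverse(1)[OF M, of "()"] by (cases "mat_inverse M") auto
  then show "minv M \<in> carrier_mat n n" "M * minv M = 1\<^sub>m n" "minv M * M = 1\<^sub>m n"
    using mat_inverse(2)[OF M B] by (auto simp: minv_def)
qed

text \<open>The definition of \<open>invertible_mat\<close> leaves the format of the inverse open;
  comparing dimensions in the two product equations fixes it.\<close>

lemma invertible_mat_iff:
  fixes M :: "real mat"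
  assumes M: "M \<in> carrier_mat n n"
  shows "invertible_mat M \<longleftrightarrow> (\<exists>N \<in> carrier_mat n n. M * N = 1\<^sub>m n)"
proof
  assume "invertible_mat M"
  then obtain N where N: "M * N = 1\<^sub>m n" "N * M = 1\<^sub>m (dim_row N)"
    using M by (auto simp: invertible_mat_def inverts_mat_def)
  have "dim_col N = n" using arg_cong[OF N(1), of dim_col] by simp
  moreover have "dim_row N = n" using arg_cong[OF N(2), of dim_col] M by simp
  ultimately show "\<exists>N \<in> carrier_mat n n. M * N = 1\<^sub>m n" using N(1) by auto
next
  assume "\<exists>N \<in> carrier_mat n n. M * N = 1\<^sub>m n"
  then show "invertible_mat M"
    using M mat_mult_left_right_inverse[OF M] by (auto simp: invertible_mat_def inverts_mat_def)
qed

lemma minv_invertible: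
  assumes M: "M \<in> carrier_mat n n" and inv: "invertible_mat M"
  shows "minv M \<in> carrier_mat n n" "M * minv M = 1\<^sub>m n" "minv M * M = 1\<^sub>m n"
proof -
  obtain N where N: "N \<in> carrier_mat n n" "M * N = 1\<^sub>m n"
    using inv invertible_mat_iff[OF M] by auto
  then show "minv M \<in> carrier_mat n n" "M * minv M = 1\<^sub>m n" "minv M * M = 1\<^sub>m n"
    using minv_unique[OF M N] mat_mult_left_right_inverse[OF M N] by auto
qed

text \<open>A zero determinant would give a nonzero kernel vector, at which the quadratic form is
  0.\<close>

lemma sym_pos_def_minv:
  assumes M: "sym_pos_def n M"
  shows "minv M \<in> carrier_mat n n" "M * minv M = 1\<^sub>m n" "minv M * M = 1\<^sub>m n"
proof -
  have cM: "M \<in> carrier_mat n n" using M by (simp add: sym_pos_def_def)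
  have "det M \<noteq> 0"
  proof
    assume "det M = 0"
    then obtain v where "v \<in> carrier_vec n" "v \<noteq> 0\<^sub>v n" "M *\<^sub>v v = 0\<^sub>v n"
      using det_0_iff_vec_prod_zero_field[OF cM] by auto
    then show False using M unfolding sym_pos_def_def by fastforce
  qed
  then show "minv M \<in> carrier_mat n n" "M * minv M = 1\<^sub>m n" "minv M * M = 1\<^sub>m n"
    using minv_det_nonzero[OF cM] by auto
qed

lemma mult_mat_index:
  fixes A :: "real mat"
  assumes "i < dim_row A" "j < dim_col B" "dim_col A = dim_row B"
  shows "(A * B) $$ (i,j) = (\<Sum>k<dim_row B. A $$ (i,k) * B $$ (k,j))"
  using assms by (simp add: scalar_prod_def lessThan_atLeast0)

text \<open>Premises on dimensions instead of carriers let the simplifier reassociate products of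
  rectangular blocks without guessing intermediate sizes.\<close>

lemma mult_assoc_dim:
  fixes A :: "real mat"
  shows "dim_col A = dim_row B \<Longrightarrow> dim_col B = dim_row C \<Longrightarrow> A * B * C = A * (B * C)"
  by (rule assoc_mult_mat) auto

lemma transpose_mult_dim:
  fixes A :: "real mat"
  shows "dim_col A = dim_row B \<Longrightarrow> transpose_mat (A * B) = transpose_mat B * transpose_mat A"
  by (rule transpose_mult) auto

section \<open>Finite sums of square matrices\<close>

text \<open>Entrywise as in \<open>EZ\<close>; the explicit size gives the empty sum its
  format.\<close>

definition mat_sum :: "nat \<Rightarrow> nat \<Rightarrow> (nat \<Rightarrow> real mat) \<Rightarrow> real mat" where
  "mat_sum n r F = mat n n (\<lambda>(a, b). \<Sum>i<r. F i $$ (a, b))"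

lemma mat_sum_carrier [simp]:
  "mat_sum n r F \<in> carrier_mat n n" "dim_row (mat_sum n r F) = n" "dim_col (mat_sum n r F) = n"
  by (auto simp: mat_sum_def)

lemma mat_sum_cong:
  "(\<And>i. i < r \<Longrightarrow> F i = G i) \<Longrightarrow> mat_sum n r F = mat_sum n r G"
  by (auto simp: mat_sum_def intro!: eq_matI)

lemma mult_mat_sum:
  assumes "M \<in> carrier_mat n n" and F: "\<And>i. i < r \<Longrightarrow> F i \<in> carrier_mat n n"
  shows "M * mat_sum n r F = mat_sum n r (\<lambda>i. M * F i)"
proof (rule eq_matI)
  fix a b assume "a < dim_row (mat_sum n r (\<lambda>i. M * F i))" "b < dim_col (mat_sum n r (\<lambda>i. M * F i))"
  then have ab: "a < n" "b < n" by auto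
  have "(M * mat_sum n r F) $$ (a,b) = (\<Sum>k<n. \<Sum>i<r. M $$ (a,k) * F i $$ (k,b))"
    using ab assms(1) by (simp add: mat_sum_def mult_mat_index sum_distrib_left del: index_mult_mat(1))
  also have "\<dots> = (\<Sum>i<r. \<Sum>k<n. M $$ (a,k) * F i $$ (k,b))" by (rule sum.swap)
  also have "\<dots> = (\<Sum>i<r. (M * F i) $$ (a,b))"
    using ab assms(1) carrier_matD[OF F] by (intro sum.cong) (auto simp: mult_mat_index simp del: index_mult_mat(1))
  finally show "(M * mat_sum n r F) $$ (a,b) = mat_sum n r (\<lambda>i. M * F i) $$ (a,b)"
    using ab by (simp add: mat_sum_def)
qed (use assms in auto)

lemma mat_sum_mult:
  assumes "M \<in> carrier_mat n n" and F: "\<And>i. i < r \<Longrightarrow> F i \<in> carrier_mat n n"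
  shows "mat_sum n r F * M = mat_sum n r (\<lambda>i. F i * M)"
proof (rule eq_matI)
  fix a b assume "a < dim_row (mat_sum n r (\<lambda>i. F i * M))" "b < dim_col (mat_sum n r (\<lambda>i. F i * M))"
  then have ab: "a < n" "b < n" by auto
  have "(mat_sum n r F * M) $$ (a,b) = (\<Sum>k<n. \<Sum>i<r. F i $$ (a,k) * M $$ (k,b))"
    using ab assms(1) by (simp add: mat_sum_def mult_mat_index sum_distrib_right del: index_mult_mat(1))
  also have "\<dots> = (\<Sum>i<r. \<Sum>k<n. F i $$ (a,k) * M $$ (k,b))" by (rule sum.swap)
  also have "\<dots> = (\<Sum>i<r. (F i * M) $$ (a,b))"
    using ab assms(1) carrier_matD[OF F] by (intro sum.cong) (auto simp: mult_mat_index simp del: index_mult_mat(1))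
  finally show "(mat_sum n r F * M) $$ (a,b) = mat_sum n r (\<lambda>i. F i * M) $$ (a,b)"
    using ab by (simp add: mat_sum_def)
qed (use assms in auto)

lemma mtrace_mat_sum:
  assumes "\<And>i. i < r \<Longrightarrow> F i \<in> carrier_mat n n"
  shows "mtrace (mat_sum n r F) = (\<Sum>i<r. mtrace (F i))"
proof -
  have "mtrace (mat_sum n r F) = (\<Sum>a<n. \<Sum>i<r. F i $$ (a,a))"
    by (simp add: mtrace_def mat_sum_def)
  also have "\<dots> = (\<Sum>i<r. \<Sum>a<n. F i $$ (a,a))" by (rule sum.swap)
  also have "\<dots> = (\<Sum>i<r. mtrace (F i))"
    using carrier_matD[OF assms] by (intro sum.cong) (auto simp: mtrace_def)
  finally show ?thesis .
qed

lemma mat_sum_single: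
  assumes "F i \<in> carrier_mat n n" "i < r" "\<And>j. j < r \<Longrightarrow> j \<noteq> i \<Longrightarrow> F j = 0\<^sub>m n n"
  shows "mat_sum n r F = F i"
proof (rule eq_matI)
  fix a b assume "a < dim_row (F i)" "b < dim_col (F i)"
  then have ab: "a < n" "b < n" using assms(1) by auto
  have "(\<Sum>j<r. F j $$ (a,b)) = (\<Sum>j\<in>{i}. F j $$ (a,b))"
    using assms ab by (intro sum.mono_neutral_right) auto
  then show "mat_sum n r F $$ (a,b) = F i $$ (a,b)" using ab by (simp add: mat_sum_def)
qed (use assms in auto)

text \<open>The diagonal entries of a Gram matrix are the squared column norms.\<close>

lemma mtrace_gram:
  "mtrace (transpose_mat F * F) = (frobenius_norm F)\<^sup>2"
proof -
  have "mtrace (transpose_mat F * F) = (\<Sum>j<dim_col F. \<Sum>i<dim_row F. (F $$ (i,j))\<^sup>2)"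
    by (simp add: mtrace_def mult_mat_index power2_eq_square del: index_mult_mat(1))
  also have "\<dots> = (\<Sum>i<dim_row F. \<Sum>j<dim_col F. (F $$ (i,j))\<^sup>2)" by (rule sum.swap)
  finally show ?thesis by (simp add: frobenius_norm_def sum_nonneg)
qed

lemma frobenius_norm_pos:
  assumes "F \<in> carrier_mat n m" "F \<noteq> 0\<^sub>m n m"
  shows "0 < frobenius_norm F"
proof -
  obtain i j where ij: "i < n" "j < m" "F $$ (i,j) \<noteq> 0"
    using assms eq_matI[of "0\<^sub>m n m" F] by auto
  have "0 < (F $$ (i,j))\<^sup>2" using ij by simp
  also have "\<dots> \<le> (\<Sum>j<m. (F $$ (i,j))\<^sup>2)" using ij by (intro member_le_sum) auto
  also have "\<dots> \<le> (\<Sum>i<n. \<Sum>j<m. (F $$ (i,j))\<^sup>2)"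
    using ij by (intro member_le_sum[of i "{..<n}" "\<lambda>i. \<Sum>j<m. (F $$ (i,j))\<^sup>2"]) (auto intro: sum_nonneg)
  finally show ?thesis using assms by (auto simp: frobenius_norm_def)
qed

text \<open>With X and Y the block rows of \<open>S\<close> and \<open>Sbar\<close>, the first claim
  reads Y^T X = I block by block; the second reads X Y^T = I with the columns grouped into
  blocks.\<close>

lemma block_row_biorthogonal:
  assumes S: "\<And>i. i < r \<Longrightarrow> S i \<in> carrier_mat n (q i)"
    and Sbar: "\<And>i. i < r \<Longrightarrow> Sbar i \<in> carrier_mat n (q i)"
    and X: "block_row n r S \<in> carrier_mat n n"
    and inv: "transpose_mat (block_row n r Sbar) * block_row n r S = 1\<^sub>m n"
  shows "\<lbrakk>i < r; j < r\<rbrakk> \<Longrightarrow> transpose_mat (Sbar i) * S j = (if i = j then 1\<^sub>m (q i) else 0\<^sub>m (q i) (q j))"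
    and "mat_sum n r (\<lambda>i. S i * transpose_mat (Sbar i)) = 1\<^sub>m n"
proof -
  let ?X = "block_row n r S" and ?Y = "block_row n r Sbar"
  have sum_q: "(\<Sum>i<r. q i) = n" using block_row_index(1)[of r S n q, OF S] X by auto
  have Y: "?Y \<in> carrier_mat n n" using block_row_index(1)[of r Sbar n q, OF Sbar] sum_q by simp
  note Xi = block_row_index(2)[of r S n q, OF S]
  note Yi = block_row_index(2)[of r Sbar n q, OF Sbar]
  \<comment> \<open>Lists of unit values stand in for blocks of the right widths; only the bound on
    positions is wanted.\<close>
  have off: "(\<Sum>j<i. q j) + k < n" if "i < r" "k < q i" for i k
    using concat_nth_offset(1)[of r "\<lambda>i. replicate (q i) ()" q i k] that sum_q by simp
  show "transpose_mat (Sbar i) * S j = (if i = j then 1\<^sub>m (q i) else 0\<^sub>m (q i) (q j))"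
    if ij: "i < r" "j < r" for i j
  proof (rule eq_matI)
    fix k l assume "k < dim_row (if i = j then 1\<^sub>m (q i) else 0\<^sub>m (q i) (q j) :: real mat)"
      "l < dim_col (if i = j then 1\<^sub>m (q i) else 0\<^sub>m (q i) (q j) :: real mat)"
    then have kl: "k < q i" "l < q j" by (auto split: if_splits)
    let ?k = "(\<Sum>a<i. q a) + k" and ?l = "(\<Sum>a<j. q a) + l"
    have "(transpose_mat (Sbar i) * S j) $$ (k,l) = (\<Sum>a<n. ?Y $$ (a,?k) * ?X $$ (a,?l))"
      using kl ij carrier_matD[OF S] carrier_matD[OF Sbar]
      by (simp add: mult_mat_index Xi Yi del: index_mult_mat(1))
    also have "\<dots> = (transpose_mat ?Y * ?X) $$ (?k,?l)"
      using off ij kl carrier_matD[OF X] carrier_matD[OF Y]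
      by (simp add: mult_mat_index del: index_mult_mat(1))
    also have "\<dots> = (if i = j then 1\<^sub>m (q i) else 0\<^sub>m (q i) (q j)) $$ (k,l)"
      unfolding inv using off ij kl offset_inject[of q i k j l] by auto
    finally show "(transpose_mat (Sbar i) * S j) $$ (k,l)
      = (if i = j then 1\<^sub>m (q i) else 0\<^sub>m (q i) (q j)) $$ (k,l)" .
  qed (use ij S[of j] Sbar[of i] in auto)
  have XY: "?X * transpose_mat ?Y = 1\<^sub>m n"
    using mat_mult_left_right_inverse[OF _ X inv] Y by simp
  show "mat_sum n r (\<lambda>i. S i * transpose_mat (Sbar i)) = 1\<^sub>m n"
  proof (rule eq_matI)
    fix a b assume "a < dim_row (1\<^sub>m n :: real mat)" "b < dim_col (1\<^sub>m n :: real mat)"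
    then have ab: "a < n" "b < n" by auto
    have "mat_sum n r (\<lambda>i. S i * transpose_mat (Sbar i)) $$ (a,b)
        = (\<Sum>i<r. \<Sum>k<q i. ?X $$ (a, (\<Sum>j<i. q j) + k) * ?Y $$ (b, (\<Sum>j<i. q j) + k))"
      unfolding mat_sum_def using ab carrier_matD[OF S] carrier_matD[OF Sbar]
      by (auto simp: mult_mat_index Xi Yi simp del: index_mult_mat(1) intro!: sum.cong)
    also have "\<dots> = (\<Sum>c<n. ?X $$ (a,c) * ?Y $$ (b,c))"
      using sum_offset[where g = "\<lambda>c. ?X $$ (a,c) * ?Y $$ (b,c)" and r = r and q = q] sum_q by simp
    also have "\<dots> = (?X * transpose_mat ?Y) $$ (a,b)"
      using ab carrier_matD[OF X] carrier_matD[OF Y]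
      by (subst mult_mat_index) auto
    finally show "mat_sum n r (\<lambda>i. S i * transpose_mat (Sbar i)) $$ (a,b) = 1\<^sub>m n $$ (a,b)"
      unfolding XY .
  qed auto
qed

section \<open>Dual blocks and the convergence rate\<close>

lemma zero_mult_dim:
  fixes A :: "real mat"
  shows "dim_row A = n \<Longrightarrow> 0\<^sub>m m n * A = 0\<^sub>m m (dim_col A)"
    and "dim_col A = n \<Longrightarrow> A * 0\<^sub>m n m = 0\<^sub>m (dim_row A) m"
  by auto

lemma smult_mult_dim:
  fixes A :: "real mat"
  shows "dim_col A = dim_row B \<Longrightarrow> (c \<cdot>\<^sub>m A) * B = c \<cdot>\<^sub>m (A * B)"
    and "dim_col A = dim_row B \<Longrightarrow> A * (c \<cdot>\<^sub>m B) = c \<cdot>\<^sub>m (A * B)"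
  by auto

lemma smult_smult_mat:
  fixes A :: "real mat"
  shows "a \<cdot>\<^sub>m (b \<cdot>\<^sub>m A) = (a * b) \<cdot>\<^sub>m A" "1 \<cdot>\<^sub>m A = A"
  by (auto intro!: eq_matI)

text \<open>The rate and the norms depend on \<open>A\<close>, \<open>S\<close> and
  \<open>Sbar\<close> only through \<open>T\<close> and \<open>U\<close>. By \<open>UT\<close> and
  \<open>sum_TU\<close> the products of \<open>T i\<close> with the transpose of \<open>U i\<close>
  are complementary projections, so the space is the direct sum of the ranges of the
  \<open>T i\<close>.\<close>

locale biorthogonal_frames =
  fixes n r :: nat and q :: "nat \<Rightarrow> nat" and W :: "real mat" and T U :: "nat \<Rightarrow> real mat"
  assumes n_pos: "0 < n" and W: "sym_pos_def n W"
    and q_pos: "i < r \<Longrightarrow> 0 < q i"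
    and T: "i < r \<Longrightarrow> T i \<in> carrier_mat n (q i)"
    and U: "i < r \<Longrightarrow> U i \<in> carrier_mat n (q i)"
    and UT: "\<lbrakk>i < r; j < r\<rbrakk> \<Longrightarrow> transpose_mat (U i) * T j = (if i = j then 1\<^sub>m (q i) else 0\<^sub>m (q i) (q j))"
    and sum_TU: "mat_sum n r (\<lambda>i. T i * transpose_mat (U i)) = 1\<^sub>m n"
begin

definition "G i = transpose_mat (T i) * W * T i"
definition "Z i = T i * minv (G i) * transpose_mat (T i)"
definition "E p = mat_sum n r (\<lambda>i. p i \<cdot>\<^sub>m Z i)"
definition "N p = mat_sum n r (\<lambda>i. (1 / p i) \<cdot>\<^sub>m (U i * G i * transpose_mat (U i)))"
text \<open>The projection onto the range of \<open>T i\<close> along the other ranges, conjugated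
  by the square root of \<open>W\<close>.\<close>

definition "F i = msqrt W * T i * transpose_mat (U i) * minv (msqrt W)"
definition "f i = frobenius_norm (F i)"

lemma W_carrier: "W \<in> carrier_mat n n"
  using W by (simp add: sym_pos_def_def)

text \<open>The transpose of \<open>U i\<close> is the left inverse of \<open>T i\<close> that the
  congruence lemma asks for.\<close>

lemma G: "i < r \<Longrightarrow> sym_pos_def (q i) (G i)"
  unfolding G_def using sym_pos_def_congruence[OF W T, of i "transpose_mat (U i)"] U[of i] UT[of i i] by simp

lemma TU: "\<lbrakk>i < r; j < r\<rbrakk> \<Longrightarrow> transpose_mat (T j) * U i = (if i = j then 1\<^sub>m (q i) else 0\<^sub>m (q j) (q i))"
proof -
  assume ij: "i < r" "j < r"
  have "transpose_mat (T j) * U i = transpose_mat (transpose_mat (U i) * T j)"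
    using T[OF ij(2)] U[OF ij(1)] by (simp add: transpose_mult_dim)
  then show ?thesis unfolding UT[OF ij] by simp
qed

lemma G_carrier: "i < r \<Longrightarrow> G i \<in> carrier_mat (q i) (q i)"
  using G by (simp add: sym_pos_def_def)

lemmas minv_G = sym_pos_def_minv[OF G]

lemmas dims = carrier_matD[OF T] carrier_matD[OF U] carrier_matD[OF G_carrier] carrier_matD[OF minv_G(1)]

lemma Z_carrier: "i < r \<Longrightarrow> Z i \<in> carrier_mat n n"
  by (rule carrier_matI) (simp_all add: Z_def dims)

text \<open>Duality leaves only the matching index. Both the inverse formula and the singular case
  rest on this.\<close>

lemma Z_mult_U: "\<lbrakk>i < r; j < r\<rbrakk> \<Longrightarrow> Z i * U j = (if i = j then T i * minv (G i) else 0\<^sub>m n (q j))"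
  unfolding Z_def using TU[of j i] by (auto simp: mult_assoc_dim dims zero_mult_dim minv_G(1))

text \<open>The cross terms vanish by \<open>Z_mult_U\<close>. In the diagonal terms the weights
  cancel and \<open>minv (G i)\<close> meets \<open>G i\<close>, leaving the projections of
  \<open>sum_TU\<close>.\<close>

lemma E_mult_N:
  assumes p: "\<And>i. i < r \<Longrightarrow> p i \<noteq> 0"
  shows "E p * N p = 1\<^sub>m n"
proof -
  have cV: "(1 / p j) \<cdot>\<^sub>m (U j * G j * transpose_mat (U j)) \<in> carrier_mat n n" if "j < r" for j
    using that by (intro carrier_matI) (simp_all add: dims)
  have "(p i \<cdot>\<^sub>m Z i) * N p = T i * transpose_mat (U i)" if i: "i < r" for i
  proof -
    have eq: "(p i \<cdot>\<^sub>m Z i) * ((1 / p j) \<cdot>\<^sub>m (U j * G j * transpose_mat (U j)))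
        = (if i = j then T i * transpose_mat (U i) else 0\<^sub>m n n)" if j: "j < r" for j
    proof -
      have "(p i \<cdot>\<^sub>m Z i) * ((1 / p j) \<cdot>\<^sub>m (U j * G j * transpose_mat (U j)))
          = (p i / p j) \<cdot>\<^sub>m (Z i * U j * G j * transpose_mat (U j))"
        using i j carrier_matD[OF Z_carrier]
        by (simp add: smult_mult_dim mult_assoc_dim dims smult_smult_mat)
      also have "\<dots> = (if i = j then T i * transpose_mat (U i) else 0\<^sub>m n n)"
      proof (cases "i = j")
        case True
        have "T j * minv (G j) * G j = T j"
          using j minv_G(3)[OF j] T[OF j] by (simp add: mult_assoc_dim dims)
        then show ?thesis using True p j by (simp add: Z_mult_U smult_smult_mat)
      next
        case False
        then show ?thesis using i j by (simp add: Z_mult_U zero_mult_dim dims)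
      qed
      finally show ?thesis .
    qed
    have "(p i \<cdot>\<^sub>m Z i) * N p = mat_sum n r (\<lambda>j. if i = j then T i * transpose_mat (U i) else 0\<^sub>m n n)"
      unfolding N_def using i Z_carrier cV by (subst mult_mat_sum) (auto simp: eq intro!: mat_sum_cong)
    also have "\<dots> = T i * transpose_mat (U i)"
      using i by (subst mat_sum_single[of _ i]) (auto simp: dims intro!: carrier_matI)
    finally show ?thesis .
  qed
  then have "E p * N p = mat_sum n r (\<lambda>i. T i * transpose_mat (U i))"
    unfolding E_def by (subst mat_sum_mult) (auto simp: N_def Z_carrier intro!: mat_sum_cong)
  then show ?thesis using sum_TU by simp
qed

lemma E_carrier: "E p \<in> carrier_mat n n" and N_carrier: "N p \<in> carrier_mat n n"
  by (simp_all add: E_def N_def)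

text \<open>With \<open>p i = 0\<close> every summand of \<open>E p\<close> annihilates
  \<open>U i\<close>, which is nonzero because it is dual to \<open>T i\<close> and
  \<open>q i\<close> is positive.\<close>

lemma E_singular:
  assumes i: "i < r" "p i = 0"
  shows "\<not> invertible_mat (E p)"
proof
  assume "invertible_mat (E p)"
  then have M: "minv (E p) \<in> carrier_mat n n" "minv (E p) * E p = 1\<^sub>m n"
    using minv_invertible[OF E_carrier] by auto
  \<comment> \<open>\<open>U i\<close> is completed to a square matrix because
    \<open>mat_sum_mult\<close> takes factors of size \<open>n\<close> by \<open>n\<close>.\<close>
  let ?Q = "U i * transpose_mat (T i)"
  have cQ: "?Q \<in> carrier_mat n n" using i by (intro carrier_matI) (simp_all add: dims)
  have "E p * ?Q = mat_sum n r (\<lambda>j. (p j \<cdot>\<^sub>m Z j) * ?Q)"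
    unfolding E_def using cQ Z_carrier by (intro mat_sum_mult) auto
  also have "\<dots> = mat_sum n r (\<lambda>j. 0\<^sub>m n n)"
  proof (rule mat_sum_cong)
    fix j assume j: "j < r"
    have "(p j \<cdot>\<^sub>m Z j) * ?Q = p j \<cdot>\<^sub>m (Z j * U i * transpose_mat (T i))"
      using i j carrier_matD[OF Z_carrier] by (simp add: smult_mult_dim mult_assoc_dim dims)
    then show "(p j \<cdot>\<^sub>m Z j) * ?Q = 0\<^sub>m n n"
      using i j by (auto simp: Z_mult_U zero_mult_dim dims intro!: eq_matI)
  qed
  also have "\<dots> = 0\<^sub>m n n" by (rule eq_matI) (auto simp: mat_sum_def)
  finally have "E p * ?Q = 0\<^sub>m n n" .
  then have "minv (E p) * E p * ?Q = 0\<^sub>m n n"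
    unfolding assoc_mult_mat[OF M(1) E_carrier cQ] using M(1) by simp
  then have Q0: "?Q = 0\<^sub>m n n" unfolding M(2) left_mult_one_mat[OF cQ] .
  have "transpose_mat (T i) * ?Q * U i = (transpose_mat (T i) * U i) * (transpose_mat (T i) * U i)"
    using i by (simp add: mult_assoc_dim dims)
  also have "\<dots> = 1\<^sub>m (q i)" using TU[of i i] i by simp
  finally have "0\<^sub>m (q i) (q i) = (1\<^sub>m (q i) :: real mat)"
    using i by (simp add: Q0 zero_mult_dim dims)
  from arg_cong[OF this, of "\<lambda>M. M $$ (0,0)"] show False using q_pos[OF i(1)] by simp
qed

lemma msqrt_W: "msqrt W \<in> carrier_mat n n" "transpose_mat (msqrt W) = msqrt W" "msqrt W * msqrt W = W"
  using msqrt[OF W] by (auto simp: sym_pos_def_def)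

lemmas minv_msqrt = sym_pos_def_minv[OF msqrt(1)[OF W]]

lemma minv_msqrt_sym: "transpose_mat (minv (msqrt W)) = minv (msqrt W)"
proof -
  have "msqrt W * transpose_mat (minv (msqrt W)) = transpose_mat (minv (msqrt W) * msqrt W)"
    using msqrt_W minv_msqrt(1) by (simp add: transpose_mult_dim)
  also have "\<dots> = 1\<^sub>m n" using minv_msqrt(3) by simp
  finally show ?thesis
    using minv_unique[OF msqrt_W(1), of "transpose_mat (minv (msqrt W))"] minv_msqrt(1) by simp
qed

lemmas dims_W = carrier_matD[OF msqrt_W(1)] carrier_matD[OF minv_msqrt(1)] carrier_matD[OF W_carrier]

lemma F_carrier: "i < r \<Longrightarrow> F i \<in> carrier_mat n n"
  by (intro carrier_matI) (simp_all add: F_def dims dims_W)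

text \<open>Writing \<open>W\<close> inside \<open>G i\<close> as the square of
  \<open>msqrt W\<close> exhibits each conjugated summand as a Gram matrix of \<open>F i\<close>.
  Where \<open>p i = 0\<close>, both sides drop the term, since division by zero gives 0.\<close>

lemma trace_N:
  "mtrace (minv (msqrt W) * N p * minv (msqrt W)) = (\<Sum>i<r. (f i)\<^sup>2 / p i)"
proof -
  let ?Ri = "minv (msqrt W)"
  let ?V = "\<lambda>i. U i * G i * transpose_mat (U i)"
  have cV: "?V i \<in> carrier_mat n n" if "i < r" for i
    using that by (intro carrier_matI) (simp_all add: dims)
  have gram: "?Ri * ?V i * ?Ri = transpose_mat (F i) * F i" if i: "i < r" for i
  proof -
    have tF: "transpose_mat (F i) = ?Ri * U i * transpose_mat (T i) * msqrt W"
      unfolding F_def using i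
      by (simp add: transpose_mult_dim mult_assoc_dim dims dims_W msqrt_W(2) minv_msqrt_sym)
    have "transpose_mat (F i) * F i
        = ?Ri * U i * transpose_mat (T i) * (msqrt W * msqrt W) * T i * transpose_mat (U i) * ?Ri"
      unfolding tF using i by (simp add: F_def mult_assoc_dim dims dims_W)
    then show ?thesis unfolding msqrt_W(3) G_def using i
      by (simp add: mult_assoc_dim dims dims_W)
  qed
  have "?Ri * N p * ?Ri = mat_sum n r (\<lambda>i. ?Ri * ((1 / p i) \<cdot>\<^sub>m ?V i)) * ?Ri"
    unfolding N_def using cV minv_msqrt(1) by (subst mult_mat_sum) auto
  also have "\<dots> = mat_sum n r (\<lambda>i. ?Ri * ((1 / p i) \<cdot>\<^sub>m ?V i) * ?Ri)"
    using cV minv_msqrt(1) by (intro mat_sum_mult) auto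
  also have "\<dots> = mat_sum n r (\<lambda>i. (1 / p i) \<cdot>\<^sub>m (transpose_mat (F i) * F i))"
    by (rule mat_sum_cong) (simp add: gram[symmetric] smult_mult_dim dims dims_W)
  also have "mtrace \<dots> = (\<Sum>i<r. mtrace ((1 / p i) \<cdot>\<^sub>m (transpose_mat (F i) * F i)))"
    using carrier_matD[OF F_carrier] by (intro mtrace_mat_sum carrier_matI) auto
  also have "\<dots> = (\<Sum>i<r. (f i)\<^sup>2 / p i)"
  proof (rule sum.cong)
    fix i assume "i \<in> {..<r}"
    have "mtrace ((1 / p i) \<cdot>\<^sub>m M) = mtrace M / p i" if "M \<in> carrier_mat n n" for M
      using that by (simp add: mtrace_def sum_divide_distrib)
    then show "mtrace ((1 / p i) \<cdot>\<^sub>m (transpose_mat (F i) * F i)) = (f i)\<^sup>2 / p i"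
      using F_carrier[of i] \<open>i \<in> {..<r}\<close> by (simp add: mtrace_gram f_def)
  qed simp
  finally show ?thesis .
qed

text \<open>Undoing the conjugation and compressing by \<open>U i\<close> and \<open>T i\<close>
  turns \<open>F i\<close> into an identity matrix of positive size. Positivity makes the optimal
  probabilities nonzero.\<close>

lemma f_pos:
  assumes i: "i < r"
  shows "0 < f i"
proof -
  have "F i \<noteq> 0\<^sub>m n n"
  proof
    assume F0: "F i = 0\<^sub>m n n"
    have "transpose_mat (U i) * (minv (msqrt W) * F i * msqrt W) * T i
       = transpose_mat (U i) * ((minv (msqrt W) * msqrt W) * T i * transpose_mat (U i) * (minv (msqrt W) * msqrt W)) * T i"
      unfolding F_def using i by (simp add: mult_assoc_dim dims dims_W)
    also have "\<dots> = (transpose_mat (U i) * T i) * (transpose_mat (U i) * T i)"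
      unfolding minv_msqrt(3) using i T[OF i] U[OF i] by (simp add: mult_assoc_dim dims)
    also have "\<dots> = 1\<^sub>m (q i)" using UT[of i i] i by simp
    finally have "0\<^sub>m (q i) (q i) = (1\<^sub>m (q i) :: real mat)"
      using i by (simp add: F0 zero_mult_dim dims dims_W)
    from arg_cong[OF this, of "\<lambda>M. M $$ (0,0)"] show False using q_pos[OF i] by simp
  qed
  then show ?thesis unfolding f_def using F_carrier[OF i] by (intro frobenius_norm_pos)
qed

text \<open>An empty sum of projections could not be the identity of positive size.\<close>

lemma r_pos: "0 < r"
proof (rule ccontr)
  assume "\<not> 0 < r"
  then have "mat_sum n r (\<lambda>i. T i * transpose_mat (U i)) $$ (0,0) = 0"
    using n_pos by (simp add: mat_sum_def)
  then show False unfolding sum_TU using n_pos by simp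
qed

section \<open>Minimisation over the simplex\<close>

text \<open>Counterpart of \<open>gamma_rate\<close> in the locale, with the probabilities as a
  function instead of a vector.\<close>

definition rate :: "(nat \<Rightarrow> real) \<Rightarrow> real" where
  "rate p = (if invertible_mat (E p)
     then 1 - 1 / mtrace (minv (msqrt W) * minv (E p) * minv (msqrt W)) else 1)"

lemma rate_pos:
  assumes "\<And>i. i < r \<Longrightarrow> p i \<noteq> 0"
  shows "rate p = 1 - 1 / (\<Sum>i<r. (f i)\<^sup>2 / p i)"
proof -
  have EN: "E p * N p = 1\<^sub>m n" using assms by (rule E_mult_N)
  have "invertible_mat (E p)" using invertible_mat_iff[OF E_carrier] EN N_carrier by blast
  then show ?thesis
    unfolding rate_def minv_unique[OF E_carrier N_carrier EN] trace_N by simp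
qed

lemma sum_f_pos: "0 < (\<Sum>i<r. f i)"
  using f_pos r_pos by (intro sum_pos) auto

text \<open>For positive probabilities this is Cauchy-Schwarz, proved termwise by completing a
  square. A zero probability makes the rate 1, which is above the bound.\<close>

lemma rate_lower_bound:
  assumes p: "\<And>i. i < r \<Longrightarrow> 0 \<le> p i" "(\<Sum>i<r. p i) = 1"
  shows "1 - 1 / (\<Sum>i<r. f i)\<^sup>2 \<le> rate p"
proof (cases "\<forall>i<r. p i \<noteq> 0")
  case True
  define s where "s = (\<Sum>i<r. f i)"
  \<comment> \<open>Expand the square of \<open>f i - s * p i\<close> and divide by
    \<open>p i\<close>; summed up, the left sides give \<open>2 * s * s - s\<^sup>2\<close>.\<close>
  have "2 * s * f i - s\<^sup>2 * p i \<le> (f i)\<^sup>2 / p i" if "i < r" for i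
  proof -
    have "0 < p i" using True p(1)[OF that] that by (simp add: order_less_le)
    moreover have "0 \<le> (f i - s * p i)\<^sup>2" by simp
    ultimately show ?thesis by (simp add: field_simps power2_eq_square)
  qed
  then have "(\<Sum>i<r. 2 * s * f i - s\<^sup>2 * p i) \<le> (\<Sum>i<r. (f i)\<^sup>2 / p i)"
    by (intro sum_mono) auto
  also have "(\<Sum>i<r. 2 * s * f i - s\<^sup>2 * p i) = s\<^sup>2"
    using p(2) by (simp add: sum_subtractf s_def power2_eq_square flip: sum_distrib_left)
  finally have "s\<^sup>2 \<le> (\<Sum>i<r. (f i)\<^sup>2 / p i)" .
  moreover have "0 < s\<^sup>2" using sum_f_pos by (simp add: s_def)
  ultimately have "1 / (\<Sum>i<r. (f i)\<^sup>2 / p i) \<le> 1 / s\<^sup>2" by (intro frac_le) auto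
  then show ?thesis using rate_pos[of p] True by (simp add: s_def)
next
  case False
  then show ?thesis using E_singular[of _ p] by (auto simp: rate_def)
qed

text \<open>The equality case: here every square \<open>(f i - s * p i)\<^sup>2\<close> from the
  lower bound vanishes.\<close>

lemma rate_attained:
  "rate (\<lambda>i. f i / (\<Sum>i<r. f i)) = 1 - 1 / (\<Sum>i<r. f i)\<^sup>2"
proof -
  define s where "s = (\<Sum>i<r. f i)"
  have s: "0 < s" using sum_f_pos by (simp add: s_def)
  have "rate (\<lambda>i. f i / s) = 1 - 1 / (\<Sum>i<r. (f i)\<^sup>2 / (f i / s))"
    using s by (intro rate_pos) (auto dest: f_pos)
  also have "(\<Sum>i<r. (f i)\<^sup>2 / (f i / s)) = (\<Sum>i<r. s * f i)"
    using s by (intro sum.cong) (auto dest!: f_pos simp: power2_eq_square)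
  also have "\<dots> = s\<^sup>2" by (simp add: s_def power2_eq_square flip: sum_distrib_left)
  finally show ?thesis by (simp add: s_def)
qed

end

section \<open>The minimum for complete discrete samplings\<close>

theorem theorem7p1:
  fixes n r :: nat and q :: "nat \<Rightarrow> nat" and A W :: "real mat" and S Sbar :: "nat \<Rightarrow> real mat"
  assumes "n \<ge> 1"
    and "A \<in> carrier_mat n n" and "invertible_mat A"
    and "sym_pos_def n W"
    and "complete_discrete_sampling n r q S"
    and "\<And>i. i < r \<Longrightarrow> Sbar i \<in> carrier_mat n (q i)"
    and "transpose_mat (minv (block_row n r S)) = block_row n r Sbar"
  defines "v \<equiv> 1 - (\<Sum>i<r. frobenius_norm
      (msqrt W * transpose_mat A * S i * transpose_mat (Sbar i) *
       transpose_mat (minv A) * minv (msqrt W))) powi (-2)"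
  shows "(\<exists>p \<in> prob_simplex r. gamma_rate n r A W S p = v) \<and>
         (\<forall>p \<in> prob_simplex r. v \<le> gamma_rate n r A W S p)"
proof -
  let ?X = "block_row n r S"
  note A = assms(2) and Sbar = assms(6)
  have S: "\<And>i. i < r \<Longrightarrow> S i \<in> carrier_mat n (q i)" and q: "\<And>i. i < r \<Longrightarrow> 0 < q i"
    and X: "?X \<in> carrier_mat n n" "vec_space.rank n ?X = n"
    using assms(5) by (auto simp: complete_discrete_sampling_def)
  \<comment> \<open>Full rank ensures that \<open>minv ?X\<close> is a genuine inverse, so the
    hypothesis on \<open>Sbar\<close> has content.\<close>
  have "det ?X \<noteq> 0" using vec_space.det_rank_iff[OF X(1)] X(2) by simp
  note minvX = minv_det_nonzero[OF X(1) this]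
  have "transpose_mat (block_row n r Sbar) * ?X = 1\<^sub>m n"
    using minvX(3) by (simp flip: assms(7))
  from block_row_biorthogonal[of r S n q Sbar, OF S Sbar X(1) this]
  have bi: "\<And>i j. \<lbrakk>i < r; j < r\<rbrakk> \<Longrightarrow> transpose_mat (Sbar i) * S j = (if i = j then 1\<^sub>m (q i) else 0\<^sub>m (q i) (q j))"
    "mat_sum n r (\<lambda>i. S i * transpose_mat (Sbar i)) = 1\<^sub>m n"
    by blast+
  note minvA = minv_invertible[OF A assms(3)]
  \<comment> \<open>\<open>A\<close> is absorbed into the blocks: the factors
    \<open>transpose_mat A\<close> and \<open>transpose_mat (minv A)\<close> cancel, so duality
    carries over from \<open>S\<close> and \<open>Sbar\<close>.\<close>
  define T where "T i = transpose_mat A * S i" for i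
  define U where "U i = minv A * Sbar i" for i
  have dimA: "dim_row A = n" "dim_col A = n" "dim_row (minv A) = n" "dim_col (minv A) = n"
    using A minvA by auto
  have dimS: "dim_row (S i) = n" "dim_col (S i) = q i" "dim_row (Sbar i) = n" "dim_col (Sbar i) = q i"
    if "i < r" for i using S[OF that] Sbar[OF that] by auto
  have cW: "W \<in> carrier_mat n n" using assms(4) by (simp add: sym_pos_def_def)
  have tA: "transpose_mat (minv A) * transpose_mat A = 1\<^sub>m n" "transpose_mat A * transpose_mat (minv A) = 1\<^sub>m n"
    using minvA dimA by (simp_all flip: transpose_mult_dim)
  have tU: "transpose_mat (U i) = transpose_mat (Sbar i) * transpose_mat (minv A)" if "i < r" for i
    unfolding U_def using that by (simp add: transpose_mult_dim dimA dimS)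
  have tT: "transpose_mat (T i) = transpose_mat (S i) * A" if "i < r" for i
    unfolding T_def using that by (simp add: transpose_mult_dim dimA dimS)
  interpret biorthogonal_frames n r q W T U
  proof
    show "transpose_mat (U i) * T j = (if i = j then 1\<^sub>m (q i) else 0\<^sub>m (q i) (q j))"
      if ij: "i < r" "j < r" for i j
    proof -
      have "transpose_mat (U i) * T j = transpose_mat (Sbar i) * ((transpose_mat (minv A) * transpose_mat A) * S j)"
        unfolding tU[OF ij(1)] T_def using ij by (simp add: mult_assoc_dim dimA dimS)
      then show ?thesis unfolding tA bi(1)[OF ij, symmetric] using S[OF ij(2)] by simp
    qed
    \<comment> \<open>The sum is the resolution of the identity for \<open>S\<close> and
      \<open>Sbar\<close>, conjugated by \<open>transpose_mat A\<close>.\<close>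
    have "mat_sum n r (\<lambda>i. T i * transpose_mat (U i))
        = mat_sum n r (\<lambda>i. transpose_mat A * (S i * transpose_mat (Sbar i)) * transpose_mat (minv A))"
      by (rule mat_sum_cong) (simp add: T_def tU mult_assoc_dim dimA dimS)
    also have "\<dots> = mat_sum n r (\<lambda>i. transpose_mat A * (S i * transpose_mat (Sbar i))) * transpose_mat (minv A)"
      by (rule mat_sum_mult[symmetric]) (auto simp: dimA dimS intro!: carrier_matI)
    also have "mat_sum n r (\<lambda>i. transpose_mat A * (S i * transpose_mat (Sbar i)))
        = transpose_mat A * mat_sum n r (\<lambda>i. S i * transpose_mat (Sbar i))"
      by (rule mult_mat_sum[symmetric]) (auto simp: dimA dimS intro!: carrier_matI)
    finally show "mat_sum n r (\<lambda>i. T i * transpose_mat (U i)) = 1\<^sub>m n"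
      unfolding bi(2) using A tA by simp
  qed (use assms(1,4) q in \<open>auto simp: T_def U_def dimA dimS intro!: carrier_matI\<close>)
  have Z: "Zmat A W (S i) = Z i" if "i < r" for i
  proof -
    have "transpose_mat (S i) * A * W * transpose_mat A * S i = G i"
      unfolding G_def tT[OF that] using that
      by (simp add: T_def mult_assoc_dim dimA dimS carrier_matD[OF cW])
    then show ?thesis
      unfolding Zmat_def Z_def tT[OF that] using that
      by (simp add: T_def mult_assoc_dim dims dimA dimS)
  qed
  have rate: "gamma_rate n r A W S p = rate (\<lambda>i. p $ i)" for p
  proof -
    have "EZ n r A W S p = E (\<lambda>i. p $ i)"
      unfolding EZ_def E_def mat_sum_def using carrier_matD[OF Z_carrier]
      by (intro eq_matI) (auto simp: Z intro!: sum.cong)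
    then show ?thesis by (simp add: gamma_rate_def rate_def)
  qed
  have F: "msqrt W * transpose_mat A * S i * transpose_mat (Sbar i) * transpose_mat (minv A) * minv (msqrt W) = F i"
    if "i < r" for i
    unfolding F_def tU[OF that] T_def using that by (simp add: mult_assoc_dim dimA dimS dims_W)
  have v: "v = 1 - 1 / (\<Sum>i<r. f i)\<^sup>2"
    unfolding v_def by (simp add: F f_def power_int_minus divide_inverse)
  have "gamma_rate n r A W S (vec r (\<lambda>i. f i / (\<Sum>i<r. f i))) = v"
  proof -
    \<comment> \<open>The two weight functions need agree only below \<open>r\<close>, the range
      that \<open>E\<close> reads.\<close>
    have "rate (\<lambda>i. vec r (\<lambda>i. f i / (\<Sum>i<r. f i)) $ i) = rate (\<lambda>i. f i / (\<Sum>i<r. f i))"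
      unfolding rate_def E_def by (simp cong: mat_sum_cong)
    then show ?thesis unfolding rate rate_attained v .
  qed
  moreover have "vec r (\<lambda>i. f i / (\<Sum>i<r. f i)) \<in> prob_simplex r"
    unfolding prob_simplex_def using sum_f_pos
    by (auto simp: less_imp_le[OF f_pos] simp flip: sum_divide_distrib intro!: divide_nonneg_nonneg)
  moreover have "v \<le> gamma_rate n r A W S p" if "p \<in> prob_simplex r" for p
    unfolding rate v using that by (intro rate_lower_bound) (auto simp: prob_simplex_def)
  ultimately show ?thesis by blast
qed

end
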